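(* Let $f$ be an expanding Lorenz map with critical point $c$, let $\hat f\colon\mathbb{X}\to\mathbb{X}$ be the induced map on the doubled space, and let $g=(f^m,f^k)$ be a renormalization of $f$. Denote $u=f^k(c_+)$, $v=f^m(c_-)$ (points of $[0,1]$) and $\hat u=\hat f^k(c_+)$, $\hat v=\hat f^m(c_-)$ (points of $\mathbb{X}$), and let $$\hat F_g=\{x\in\mathbb{X}:\ \mathrm{Orb}(x)\cap(\hat u,\hat v)\neq\emptyset\}.$$ Then the following hold. (1) The set $\hat F_g$ is completely invariant under $\hat f$ if and only if $\mathrm{Orb}(u)\cap(u,v)\neq\emptyset$ and $\mathrm{Orb}(v)\cap(u,v)\neq\emptyset$ (orbits under $f$). (2) If $\hat F_g$ is completely invariant under $\hat f$, then: (a) $\bigcup_{n\ge 0}\hat f^n((\hat u,\hat v))\subset\hat F_g$; (b) for every $x\in[0,u)$ and every $y\in(v,1]$ we have $\mathrm{Orb}(x)\cap(u,1]\neq\emptyset$ and $\mathrm{Orb}(y)\cap[0,v)\neq\emptyset$; (c) $f(x)\neq x$ for every $x\in[0,1]$; (d) if $f(u)\in(u,v)$ or $f(v)\in(u,v)$, then $\hat F_g=\mathbb{X}$.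
   Context: **Expanding Lorenz map.** A map $f\colon[0,1]\to[0,1]$ such that: (i) there is a critical point $c\in(0,1)$ such that $f$ is continuous and strictly increasing on $[0,c)$ and on $(c,1]$; (ii) $\lim_{x\to c^-}f(x)=1$ and $\lim_{x\to c^+}f(x)=0$; (iii) $f$ is differentiable outside a finite set $F\subseteq[0,1]$ and $\inf_{x\notin F}f'(x)>1$. The value $f(c)$ is taken to be $0$ or $1$ (either choice). For $a\in[0,1]$, $f^n(a_+)$ and $f^n(a_-)$ denote the right and left one-sided limits of $f^n$ at $a$. $\mathrm{Orb}(x)$ is the forward orbit of $x$, including $x$. **Doubled space.** Let $A=\left(\bigcup_{n\ge0}f^{-n}(c)\right)\setminus\{0,1\}$. The space $\mathbb{X}$ is obtained from $[0,1]$ by replacing each $a\in A$ by two points $a_-<a_+$, with the induced linear order and the order topology; it is a Cantor set. Let $\pi\colon\mathbb{X}\to[0,1]$ be the continuous projection gluing $a_-,a_+$ to $a$. Points with a single $\pi$-preimage are identified with their preimage. The continuous map $\hat f\colon\mathbb{X}\to\mathbb{X}$ is given by: $\hat f(c_-)=1$, $\hat f(c_+)=0$; $\hat f(a_\pm)=f(a)_\pm$ for $a\in A\setminus\{c\}$; $\hat f(x)=f(x)$ for $x\in[0,1]\setminus(A\cup\{0,1\})$; $\hat f(0)=f(0)_+$ if $f(0)\in A$ and $\hat f(0)=f(0)$ otherwise; $\hat f(1)=f(1)_-$ if $f(1)\in A$ and $\hat f(1)=f(1)$ otherwise. Intervals in $\mathbb{X}$ are with respect to its linear order. **Renormalization.**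 A map $g$ is a Lorenz map on $[u,v]$ if conjugating it by the increasing linear homeomorphism $[u,v]\to[0,1]$ gives an (expanding) Lorenz map on $[0,1]$. If there are a proper subinterval $(u,v)\ni c$ of $(0,1)$ and integers $l,r>1$ such that $g\colon[u,v]\to[u,v]$, $g(x)=f^l(x)$ for $x\in[u,c)$, $g(x)=f^r(x)$ for $x\in(c,v]$, is a Lorenz map on $[u,v]$ (with critical point $c$), then $g$ is a renormalization of $f$, written $g=(f^l,f^r)$, with renormalization interval $[u,v]$; necessarily $[u,v]=[f^r(c_+),f^l(c_-)]$. If the orbit of $0$ or $1$ hits $c$, the endpoint values are understood as $g(u)=f^l(u_+)$ and $g(v)=f^r(v_-)$. **Complete invariance.** A nonempty set $\hat E\subset\mathbb{X}$ is completely invariant under $\hat f$ if $\hat f(\hat E)=\hat E=\hat f^{-1}(\hat E)$. *)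

theory Defs
  imports "HOL-Analysis.Analysis"
begin

section \<open>Expanding Lorenz maps and renormalizations\<close>

text \<open>
  A self-map of \<open>[0,1]\<close> is a function \<open>real \<Rightarrow> real\<close> whose values outside \<open>{0..1}\<close> are irrelevant;
  derivatives at \<open>0\<close> and \<open>1\<close> are one-sided. Monotonicity forces \<open>D \<ge> 0\<close>, and the index set is
  nonempty because \<open>F\<close> is finite, so the infimum is a genuine one. As \<open>f\<close> is discontinuous at
  \<open>c\<close>, the set \<open>F\<close> necessarily contains \<open>c\<close>.
\<close>

definition expanding_lorenz :: "(real \<Rightarrow> real) \<Rightarrow> real \<Rightarrow> bool" where
  "expanding_lorenz f c \<longleftrightarrow>
     f ` {0..1} \<subseteq> {0..1} \<and> 0 < c \<and> c < 1 \<and>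
     continuous_on {0..<c} f \<and> strict_mono_on {0..<c} f \<and>
     continuous_on {c<..1} f \<and> strict_mono_on {c<..1} f \<and>
     (f \<longlongrightarrow> 1) (at_left c) \<and> (f \<longlongrightarrow> 0) (at_right c) \<and>
     (\<exists>F D. finite F \<and> F \<subseteq> {0..1} \<and>
        (\<forall>x\<in>{0..1} - F. (f has_real_derivative D x) (at x within {0..1})) \<and>
        (INF x\<in>{0..1} - F. D x) > 1) \<and>
     (f c = 0 \<or> f c = 1)"

definition lorenz_on :: "real \<Rightarrow> real \<Rightarrow> (real \<Rightarrow> real) \<Rightarrow> real \<Rightarrow> bool" where
  "lorenz_on u v g c \<longleftrightarrow>
     u < v \<and> expanding_lorenz (\<lambda>t. (g (u + (v - u) * t) - u) / (v - u)) ((c - u) / (v - u))"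

text \<open>The one-sided limits \<open>f\<^sup>n(a\<^sub>+)\<close> and \<open>f\<^sup>n(a\<^sub>-)\<close>.\<close>

definition iter_right :: "(real \<Rightarrow> real) \<Rightarrow> nat \<Rightarrow> real \<Rightarrow> real" where
  "iter_right f n a = Lim (at_right a) (f ^^ n)"

definition iter_left :: "(real \<Rightarrow> real) \<Rightarrow> nat \<Rightarrow> real \<Rightarrow> real" where
  "iter_left f n a = Lim (at_left a) (f ^^ n)"

text \<open>
  \<open>renormalization f c l r g\<close> says that \<open>g = (f\<^sup>l, f\<^sup>r)\<close> is a renormalization of \<open>f\<close>. The endpoint
  values are always taken as one-sided limits: this is the convention when the orbit of \<open>0\<close> or \<open>1\<close>
  hits \<open>c\<close>, and otherwise \<open>f\<^sup>l\<close> is continuous at \<open>u\<close> and \<open>f\<^sup>r\<close> at \<open>v\<close> from inside \<open>[u,v]\<close>, so that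
  the limits are just \<open>f\<^sup>l(u)\<close> and \<open>f\<^sup>r(v)\<close>. The value \<open>g c\<close> is constrained only by
  \<open>lorenz_on\<close>, i.e. it is \<open>u\<close> or \<open>v\<close>.
\<close>

definition renormalization ::
  "(real \<Rightarrow> real) \<Rightarrow> real \<Rightarrow> nat \<Rightarrow> nat \<Rightarrow> (real \<Rightarrow> real) \<Rightarrow> bool" where
  "renormalization f c l r g \<longleftrightarrow>
     l > 1 \<and> r > 1 \<and>
     (\<exists>u v. {u<..<v} \<subset> {0<..<1} \<and> c \<in> {u<..<v} \<and>
        (\<forall>x\<in>{u<..<c}. g x = (f ^^ l) x) \<and> (\<forall>x\<in>{c<..<v}. g x = (f ^^ r) x) \<and>
        g u = iter_right f l u \<and> g v = iter_left f r v \<and>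
        lorenz_on u v g c)"

section \<open>Orbits and complete invariance\<close>

definition Orb :: "('a \<Rightarrow> 'a) \<Rightarrow> 'a \<Rightarrow> 'a set" where
  "Orb h x = {(h ^^ n) x | n. True}"

definition completely_invariant :: "'a set \<Rightarrow> ('a \<Rightarrow> 'a) \<Rightarrow> 'a set \<Rightarrow> bool" where
  "completely_invariant X h E \<longleftrightarrow>
     E \<noteq> {} \<and> E \<subseteq> X \<and> h ` E = E \<and> E = {x \<in> X. h x \<in> E}"

section \<open>The doubled space\<close>

definition doubled_pts :: "(real \<Rightarrow> real) \<Rightarrow> real \<Rightarrow> real set" where
  "doubled_pts f c = {a \<in> {0..1}. \<exists>n. (f ^^ n) a = c} - {0, 1}"

text \<open>
  \<open>Minus a\<close> and \<open>Plus a\<close> are the two copies \<open>a\<^sub>- < a\<^sub>+\<close> of a doubled point \<open>a\<close>; \<open>Pt x\<close> is a point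
  with a single preimage under the projection.
\<close>

datatype dpoint = Pt real | Minus real | Plus real

fun proj :: "dpoint \<Rightarrow> real" where
  "proj (Pt x) = x"
| "proj (Minus a) = a"
| "proj (Plus a) = a"

definition doubled_space :: "(real \<Rightarrow> real) \<Rightarrow> real \<Rightarrow> dpoint set" where
  "doubled_space f c =
     Pt ` ({0..1} - doubled_pts f c) \<union> Minus ` doubled_pts f c \<union> Plus ` doubled_pts f c"

definition dless :: "dpoint \<Rightarrow> dpoint \<Rightarrow> bool" where
  "dless p q \<longleftrightarrow> proj p < proj q \<or> (\<exists>a. p = Minus a \<and> q = Plus a)"

definition dinterval :: "(real \<Rightarrow> real) \<Rightarrow> real \<Rightarrow> dpoint \<Rightarrow> dpoint \<Rightarrow> dpoint set" where
  "dinterval f c p q = {x \<in> doubled_space f c. dless p x \<and> dless x q}"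

fun fhat :: "(real \<Rightarrow> real) \<Rightarrow> real \<Rightarrow> dpoint \<Rightarrow> dpoint" where
  "fhat f c (Minus a) = (if a = c then Pt 1 else Minus (f a))"
| "fhat f c (Plus a) = (if a = c then Pt 0 else Plus (f a))"
| "fhat f c (Pt x) =
     (if x = 0 \<and> f 0 \<in> doubled_pts f c then Plus (f 0)
      else if x = 1 \<and> f 1 \<in> doubled_pts f c then Minus (f 1)
      else Pt (f x))"

text \<open>The set \<open>F\<^sub>g\<close> of points of the doubled space whose orbit meets the open interval from
  \<open>p\<close> to \<open>q\<close>.\<close>

definition Fhat :: "(real \<Rightarrow> real) \<Rightarrow> real \<Rightarrow> dpoint \<Rightarrow> dpoint \<Rightarrow> dpoint set" where
  "Fhat f c p q = {x \<in> doubled_space f c. Orb (fhat f c) x \<inter> dinterval f c p q \<noteq> {}}"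

end

theory Submission
  imports Defs
begin

text \<open>
  Since \<open>u\<^sub>h\<close> is never a left copy and \<open>v\<^sub>h\<close> never a right copy, the interval from \<open>u\<^sub>h\<close> to \<open>v\<^sub>h\<close>
  consists of the points whose projection lies in \<open>(u,v)\<close>; and as long as an orbit has not met
  \<open>c \<in> (u,v)\<close>, the lifted map projects to \<open>f\<close>. Hence \<open>F\<^sub>g\<close> is the set of points whose projection has
  an \<open>f\<close>-orbit that meets \<open>(u,v)\<close>. The lifted map is surjective because \<open>f 0 < f 1\<close>, so complete
  invariance of \<open>F\<^sub>g\<close> just says that the interval is mapped into \<open>F\<^sub>g\<close>. The \<open>n\<close>-th lifted iterate
  projects to a one-sided limit of \<open>f\<^sup>n\<close>, so the iterates \<open>m\<close> and \<open>k\<close> map the two halves of the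
  interval into the interval, except that \<open>c\<^sub>-\<close> and \<open>c\<^sub>+\<close> go to \<open>v\<^sub>h\<close> and \<open>u\<^sub>h\<close>. The remaining claims
  follow from \<open>f x - x \<ge> f 0\<close> to the left of \<open>c\<close> and \<open>x - f x \<ge> 1 - f 1\<close> to the right of it.
\<close>

section \<open>Growth and sign of a derivative\<close>

text \<open>A mean value inequality with finitely many exceptional points, obtained by integrating
  the derivative.\<close>

lemma growth_from_derivative_bound:
  fixes f :: "real \<Rightarrow> real"
  assumes "finite S" "a \<le> b" "continuous_on {a..b} f"
    and der: "\<And>x. x \<in> {a<..<b} - S \<Longrightarrow> (f has_real_derivative D x) (at x)"
    and bound: "\<And>x. x \<in> {a<..<b} - S \<Longrightarrow> lam \<le> D x"
  shows "lam * (b - a) \<le> f b - f a"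
proof -
  have "(D has_integral (f b - f a)) {a..b}"
    using assms by (intro fundamental_theorem_of_calculus_interior_strong[of S])
      (auto simp: has_real_derivative_iff_has_vector_derivative)
  \<comment> \<open>\<open>D\<close> is not controlled at the exceptional points and the ends;
    resetting it to \<open>lam\<close> there keeps the integral and makes the comparison hold
    everywhere.\<close>
  then have D: "((\<lambda>x. if x \<in> insert a (insert b S) then lam else D x) has_integral (f b - f a)) {a..b}"
    by (rule has_integral_spike_finite[where S = "insert a (insert b S)", rotated -1])
      (use assms(1) in auto)
  have lam: "((\<lambda>x. lam) has_integral (lam * (b - a))) {a..b}"
    using has_integral_const_real[of lam a b] assms(2) by (simp add: mult.commute)
  show ?thesis
    by (rule has_integral_le[OF lam D]) (use bound in auto)
qed

text \<open>A negative derivative would make \<open>f\<close> decrease just to the right of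
  \<open>x\<close>. This is the source of the lower bound that gives the infimum of the derivative
  its meaning.\<close>

lemma strict_mono_on_imp_DERIV_nonneg:
  fixes f :: "real \<Rightarrow> real"
  assumes "strict_mono_on S f" "open U" "U \<subseteq> S" "x \<in> U" "(f has_real_derivative D) (at x)"
  shows "0 \<le> D"
proof (rule ccontr)
  assume "\<not> 0 \<le> D"
  then obtain d where d: "d > 0" "\<And>h. h > 0 \<Longrightarrow> h < d \<Longrightarrow> f (x + h) < f x"
    using DERIV_neg_dec_right[OF assms(5)] by auto
  obtain e where e: "e > 0" "ball x e \<subseteq> U"
    using assms(2,4) openE by blast
  define h where "h = min d e / 2"
  have h: "h > 0" "h < d" "h < e"
    using d(1) e(1) by (auto simp: h_def min_def)
  then have "x + h \<in> U"
    using e(2) by (auto simp: dist_real_def subset_iff)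
  then have "f x < f (x + h)"
    using assms(1,3,4) h(1) by (intro strict_mono_onD[of S f]) auto
  then show False
    using d(2)[OF h(1,2)] by simp
qed

section \<open>Expanding Lorenz maps\<close>

locale lorenz_map =
  fixes f :: "real \<Rightarrow> real" and c :: real
  assumes expanding: "expanding_lorenz f c"
begin

lemma c_bounds: "0 < c" "c < 1"
  using expanding by (auto simp: expanding_lorenz_def)

lemma maps_unit: "x \<in> {0..1} \<Longrightarrow> f x \<in> {0..1}"
  using expanding unfolding expanding_lorenz_def by blast

lemma funpow_unit: "x \<in> {0..1} \<Longrightarrow> (f ^^ n) x \<in> {0..1}"
  by (induction n) (use maps_unit in auto)

lemma cont_left: "continuous_on {0..<c} f"
  and cont_right: "continuous_on {c<..1} f"
  and mono_left: "strict_mono_on {0..<c} f"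
  and mono_right: "strict_mono_on {c<..1} f"
  and lim_left: "(f \<longlongrightarrow> 1) (at_left c)"
  and lim_right: "(f \<longlongrightarrow> 0) (at_right c)"
  and f_c: "f c = 0 \<or> f c = 1"
  using expanding by (simp_all add: expanding_lorenz_def)

lemma less_one:
  assumes "0 \<le> x" "x < 1" "x \<noteq> c"
  shows "f x < 1"
proof -
  \<comment> \<open>A point \<open>y\<close> further right on the same branch gives
    \<open>f x < f y \<le> 1\<close>.\<close>
  have "x < (if x < c then c else 1)"
    using assms by simp
  then obtain y where y: "x < y" "y < (if x < c then c else 1)"
    using dense by blast
  have "f x < f y"
    using strict_mono_onD[OF mono_left, of x y] strict_mono_onD[OF mono_right, of x y] assms y c_bounds
    by (auto split: if_splits)
  then show ?thesis
    using maps_unit[of y] assms y c_bounds by (auto split: if_splits)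
qed

lemma greater_zero:
  assumes "0 < x" "x \<le> 1" "x \<noteq> c"
  shows "0 < f x"
proof -
  have "(if x < c then 0 else c) < x"
    using assms by simp
  then obtain y where y: "(if x < c then 0 else c) < y" "y < x"
    using dense by blast
  have "f y < f x"
    using strict_mono_onD[OF mono_left, of y x] strict_mono_onD[OF mono_right, of y x] assms y c_bounds
    by (auto split: if_splits)
  then show ?thesis
    using maps_unit[of y] assms y c_bounds by (auto split: if_splits)
qed

section \<open>Uniform expansion and its consequences\<close>

text \<open>The constant is the infimum of the derivative. The branches are integrated separately
  because \<open>f\<close> jumps at \<open>c\<close>.\<close>

lemma expansion:
  obtains lam where "lam > 1"
    and "\<And>x y. 0 \<le> x \<Longrightarrow> x \<le> y \<Longrightarrow> y < c \<Longrightarrow> lam * (y - x) \<le> f y - f x"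
    and "\<And>x y. c < x \<Longrightarrow> x \<le> y \<Longrightarrow> y \<le> 1 \<Longrightarrow> lam * (y - x) \<le> f y - f x"
proof -
  obtain S D where S: "finite S"
    and D: "\<And>x. x \<in> {0..1} - S \<Longrightarrow> (f has_real_derivative D x) (at x within {0..1})"
    and inf: "(INF x\<in>{0..1} - S. D x) > 1"
    using expanding unfolding expanding_lorenz_def by blast
  define lam where "lam = (INF x\<in>{0..1} - S. D x)"
  have D': "(f has_real_derivative D x) (at x)" if "x \<in> {0<..<1} - S" for x
    using D[of x] that at_within_interior[of x "{0..1}"] by (simp add: interior_atLeastAtMost_real)
  have nonneg: "0 \<le> D x" if "x \<in> {0<..<1} - S" "x \<noteq> c" for x
    using strict_mono_on_imp_DERIV_nonneg[OF mono_left, of "{0<..<c}" x "D x"]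
      strict_mono_on_imp_DERIV_nonneg[OF mono_right, of "{c<..<1}" x "D x"] D'[of x] that
    by (cases "x < c") (auto simp: subset_iff)
  \<comment> \<open>Without a lower bound the infimum would be a junk value.\<close>
  have "bdd_below (D ` ({0..1} - S))"
  proof (rule bdd_belowI)
    fix y assume "y \<in> D ` ({0..1} - S)"
    then obtain x where x: "x \<in> {0..1} - S" "y = D x"
      by auto
    consider "x \<in> {0, 1, c}" | "x \<in> {0<..<1} - S" "x \<noteq> c"
      using x(1) by force
    \<comment> \<open>\<open>nonneg\<close> does not cover the ends and \<open>c\<close>, so the
      values of \<open>D\<close> there enter the bound directly.\<close>
    then show "Min {0, D 0, D 1, D c} \<le> y"
    proof cases
      case 1
      then show ?thesis using x(2) by (intro Min_le) auto
    next
      case 2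
      then show ?thesis
        using nonneg[of x] x(2) by (intro order.trans[OF Min_le[of _ 0]]) auto
    qed
  qed
  then have lam_le: "lam \<le> D x" if "x \<in> {0..1} - S" for x
    unfolding lam_def using that by (intro cINF_lower)
  show ?thesis
  proof
    show "lam > 1"
      using inf by (simp add: lam_def)
    show "lam * (y - x) \<le> f y - f x" if "0 \<le> x" "x \<le> y" "y < c" for x y
      using that c_bounds
      by (intro growth_from_derivative_bound[OF S, of _ _ _ D] continuous_on_subset[OF cont_left] D' lam_le) auto
    show "lam * (y - x) \<le> f y - f x" if "c < x" "x \<le> y" "y \<le> 1" for x y
      using that c_bounds
      by (intro growth_from_derivative_bound[OF S, of _ _ _ D] continuous_on_subset[OF cont_right] D' lam_le) auto
  qed
qed

text \<open>Slopes above 1 make \<open>f x - x\<close> increase along the left branch, so it is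
  smallest at \<open>0\<close>.\<close>

lemma displacement_left:
  assumes "0 \<le> x" "x < c"
  shows "f 0 \<le> f x - x"
proof -
  obtain lam where "lam > 1" and *: "\<And>x y. 0 \<le> x \<Longrightarrow> x \<le> y \<Longrightarrow> y < c \<Longrightarrow> lam * (y - x) \<le> f y - f x"
    using expansion by metis
  have "1 * x \<le> lam * x"
    using assms \<open>lam > 1\<close> by (intro mult_right_mono) auto
  then show ?thesis
    using *[of 0 x] assms by simp
qed

text \<open>On the right branch \<open>x - f x\<close> decreases, so it is smallest at
  \<open>1\<close>.\<close>

lemma displacement_right:
  assumes "c < x" "x \<le> 1"
  shows "1 - f 1 \<le> x - f x"
proof -
  obtain lam where "lam > 1" and *: "\<And>x y. c < x \<Longrightarrow> x \<le> y \<Longrightarrow> y \<le> 1 \<Longrightarrow> lam * (y - x) \<le> f y - f x"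
    using expansion by metis
  have "1 * (1 - x) \<le> lam * (1 - x)"
    using assms \<open>lam > 1\<close> by (intro mult_right_mono) auto
  then show ?thesis
    using *[of x 1] assms by simp
qed

text \<open>The branches are too steep for their images to be disjoint.\<close>

lemma f_0_less_f_1: "f 0 < f 1"
proof -
  obtain lam where "lam > 1"
    and l: "\<And>x y. 0 \<le> x \<Longrightarrow> x \<le> y \<Longrightarrow> y < c \<Longrightarrow> lam * (y - x) \<le> f y - f x"
    and r: "\<And>x y. c < x \<Longrightarrow> x \<le> y \<Longrightarrow> y \<le> 1 \<Longrightarrow> lam * (y - x) \<le> f y - f x"
    using expansion by metis
  \<comment> \<open>Letting \<open>y\<close> tend to \<open>c\<close> bounds the length of the left
    branch by \<open>(1 - f 0) / lam\<close>, and likewise that of the right one by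
    \<open>f 1 / lam\<close>. The lengths add up to 1, so
    \<open>lam \<le> 1 - f 0 + f 1\<close>.\<close>
  have lc: "c \<le> (1 - f 0) / lam"
  proof (rule dense_le_bounded[OF c_bounds(1)])
    fix y assume "0 < y" "y < c"
    then show "y \<le> (1 - f 0) / lam"
      using l[of 0 y] less_one[of y] \<open>lam > 1\<close> c_bounds by (simp add: field_simps)
  qed
  have rc: "1 - f 1 / lam \<le> c"
  proof (rule dense_ge_bounded[OF c_bounds(2)])
    fix y assume "c < y" "y < 1"
    then show "1 - f 1 / lam \<le> y"
      using r[of y 1] greater_zero[of y] \<open>lam > 1\<close> c_bounds by (simp add: field_simps)
  qed
  have "lam - f 1 \<le> lam * c"
    using mult_left_mono[OF rc, of lam] \<open>lam > 1\<close> by (simp add: right_diff_distrib)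
  moreover have "lam * c \<le> 1 - f 0"
    using mult_left_mono[OF lc, of lam] \<open>lam > 1\<close> by simp
  ultimately show ?thesis
    using \<open>lam > 1\<close> by linarith
qed

text \<open>The left branch covers \<open>(f 0, 1)\<close> and the right one
  \<open>(0, f 1)\<close>, and these overlap since \<open>f 0 < f 1\<close>. The preimage has to
  avoid \<open>0\<close>, \<open>1\<close> and \<open>c\<close>, where the lifted map has special
  clauses.\<close>

lemma interior_preimage:
  assumes "0 < y" "y < 1"
  obtains x where "0 < x" "x < 1" "x \<noteq> c" "f x = y"
proof (cases "f 0 < y")
  case True
  \<comment> \<open>Near \<open>c\<close> the values exceed \<open>y\<close>, so the intermediate
    value theorem applies on a closed interval short of the jump.\<close>
  have "eventually (\<lambda>z. y < f z \<and> 0 < z \<and> z < c) (at_left c)"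
    using order_tendstoD(1)[OF lim_left, of y] assms eventually_at_left_real[OF c_bounds(1)]
    by (auto elim: eventually_elim2)
  then obtain z where z: "y < f z" "0 < z" "z < c"
    using eventually_happens trivial_limit_at_left_real by blast
  obtain x where "0 \<le> x" "x \<le> z" "f x = y"
    using IVT'[of f 0 y z] True z continuous_on_subset[OF cont_left, of "{0..z}"] by (auto simp: subset_iff)
  moreover have "x \<noteq> 0"
    using True \<open>f x = y\<close> by auto
  ultimately show ?thesis
    using z c_bounds by (intro that[of x]) auto
next
  case False
  then have y: "y < f 1"
    using f_0_less_f_1 by simp
  have "eventually (\<lambda>z. f z < y \<and> c < z \<and> z < 1) (at_right c)"
    using order_tendstoD(2)[OF lim_right, of y] assms eventually_at_right_real[OF c_bounds(2)]
    by (auto elim: eventually_elim2)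
  then obtain z where z: "f z < y" "c < z" "z < 1"
    using eventually_happens trivial_limit_at_right_real by blast
  obtain x where "z \<le> x" "x \<le> 1" "f x = y"
    using IVT'[of f z y 1] y z continuous_on_subset[OF cont_right, of "{z..1}"] by (auto simp: subset_iff)
  moreover have "x \<noteq> 1"
    using y \<open>f x = y\<close> by auto
  ultimately show ?thesis
    using z c_bounds by (intro that[of x]) auto
qed

section \<open>Fixed points and drift of orbits\<close>

lemma no_fixed_point:
  assumes "0 < f 0" "f 1 < 1" "x \<in> {0..1}"
  shows "f x \<noteq> x"
  using displacement_left[of x] displacement_right[of x] f_c c_bounds assms
  by (cases x c rule: linorder_cases) auto

text \<open>While it stays in \<open>[0, w]\<close>, the orbit gains at least \<open>f 0\<close> per
  step by \<open>displacement_left\<close>, so it must leave; \<open>n\<close> is the first time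
  this happens.\<close>

lemma orbit_climbs:
  assumes "0 < f 0" "0 \<le> x" "w < c"
  obtains n where "(f ^^ n) x > w" "\<And>j. j < n \<Longrightarrow> 0 \<le> (f ^^ j) x \<and> (f ^^ j) x \<le> w"
proof -
  have "\<exists>n. (f ^^ n) x > w"
  proof (rule ccontr)
    assume "\<not> (\<exists>n. (f ^^ n) x > w)"
    then have le: "(f ^^ n) x \<le> w" for n
      by (simp add: not_less)
    have grow: "real n * f 0 \<le> (f ^^ n) x" for n
    proof (induction n)
      case (Suc n)
      then have "0 \<le> (f ^^ n) x"
        using assms(1) by (smt (verit) mult_nonneg_nonneg of_nat_0_le_iff)
      then show ?case
        using displacement_left[of "(f ^^ n) x"] le[of n] assms(3) Suc by (simp add: algebra_simps)
    qed (use assms in simp)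
    obtain n where "w < real n * f 0"
      using reals_Archimedean3[OF assms(1)] by blast
    then show False
      using grow[of n] le[of n] by simp
  qed
  then obtain n where n: "(f ^^ n) x > w" "\<And>j. j < n \<Longrightarrow> \<not> (f ^^ j) x > w"
    using exists_least_iff[of "\<lambda>n. (f ^^ n) x > w"] by blast
  have nonneg: "0 \<le> (f ^^ j) x" if "j < n" for j
    using that
  proof (induction j)
    case (Suc j)
    then show ?case
      using displacement_left[of "(f ^^ j) x"] n(2)[of j] assms by auto
  qed (use assms in simp)
  then show ?thesis
    using n nonneg by (intro that[of n]) (auto simp: not_less)
qed

text \<open>Mirror image of \<open>orbit_climbs\<close>: each step in \<open>[w, 1]\<close> loses at
  least \<open>1 - f 1\<close>.\<close>

lemma orbit_descends:
  assumes "f 1 < 1" "x \<le> 1" "c < w"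
  obtains n where "(f ^^ n) x < w" "\<And>j. j < n \<Longrightarrow> (f ^^ j) x \<le> 1 \<and> w \<le> (f ^^ j) x"
proof -
  have "\<exists>n. (f ^^ n) x < w"
  proof (rule ccontr)
    assume "\<not> (\<exists>n. (f ^^ n) x < w)"
    then have le: "w \<le> (f ^^ n) x" for n
      by (simp add: not_less)
    have grow: "(f ^^ n) x \<le> 1 - real n * (1 - f 1)" for n
    proof (induction n)
      case (Suc n)
      then have "(f ^^ n) x \<le> 1"
        using assms(1) by (smt (verit) mult_nonneg_nonneg of_nat_0_le_iff)
      then show ?case
        using displacement_right[of "(f ^^ n) x"] le[of n] assms(3) Suc by (simp add: algebra_simps)
    qed (use assms in simp)
    obtain n where "1 - w < real n * (1 - f 1)"
      using reals_Archimedean3[of "1 - f 1"] assms(1) by auto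
    then show False
      using grow[of n] le[of n] by simp
  qed
  then obtain n where n: "(f ^^ n) x < w" "\<And>j. j < n \<Longrightarrow> \<not> (f ^^ j) x < w"
    using exists_least_iff[of "\<lambda>n. (f ^^ n) x < w"] by blast
  have le_one: "(f ^^ j) x \<le> 1" if "j < n" for j
    using that
  proof (induction j)
    case (Suc j)
    then show ?case
      using displacement_right[of "(f ^^ j) x"] n(2)[of j] assms by auto
  qed (use assms in simp)
  then show ?thesis
    using n le_one by (intro that[of n]) (auto simp: not_less)
qed

section \<open>One-sided limits along the branches\<close>

text \<open>Stronger than continuity from the right: by strict monotonicity the values stay strictly
  above \<open>f x\<close>, so such limits can be composed along iterates.\<close>

lemma f_at_right:
  assumes "0 \<le> x" "x < 1" "x \<noteq> c"
  shows "filterlim f (at_right (f x)) (at_right x)"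
proof (rule tendsto_imp_filterlim_at_right)
  obtain b S where b: "x < b" "{x..b} \<subseteq> S" "continuous_on S f" "strict_mono_on S f"
  proof (cases "x < c")
    case True
    show ?thesis
      by (rule that[OF _ _ cont_left mono_left, of "(x + c) / 2"]) (use assms True in auto)
  next
    case False
    show ?thesis
      by (rule that[OF _ _ cont_right mono_right, of "(x + 1) / 2"]) (use assms False in auto)
  qed
  then have "continuous_on {x..b} f"
    using continuous_on_subset by blast
  then show "(f \<longlongrightarrow> f x) (at_right x)"
    using b(1) by (rule continuous_on_Icc_at_rightD)
  show "eventually (\<lambda>y. f x < f y) (at_right x)"
    using eventually_at_right_real[OF b(1)]
    by eventually_elim (use b in \<open>auto intro!: strict_mono_onD[OF b(4)]\<close>)
qed

lemma f_at_left:
  assumes "0 < x" "x \<le> 1" "x \<noteq> c"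
  shows "filterlim f (at_left (f x)) (at_left x)"
proof (rule tendsto_imp_filterlim_at_left)
  obtain b S where b: "b < x" "{b..x} \<subseteq> S" "continuous_on S f" "strict_mono_on S f"
  proof (cases "x < c")
    case True
    show ?thesis
      by (rule that[OF _ _ cont_left mono_left, of "x / 2"]) (use assms True in auto)
  next
    case False
    show ?thesis
      by (rule that[OF _ _ cont_right mono_right, of "(c + x) / 2"]) (use assms False in auto)
  qed
  then have "continuous_on {b..x} f"
    using continuous_on_subset by blast
  then show "(f \<longlongrightarrow> f x) (at_left x)"
    using b(1) by (rule continuous_on_Icc_at_leftD)
  show "eventually (\<lambda>y. f y < f x) (at_left x)"
    using eventually_at_left_real[OF b(1)]
    by eventually_elim (use b in \<open>auto intro!: strict_mono_onD[OF b(4)]\<close>)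
qed

text \<open>The jump in the same form; the limit \<open>0\<close> is the projection of
  \<open>fhat f c (Plus c)\<close>.\<close>

lemma f_at_right_c: "filterlim f (at_right 0) (at_right c)"
proof (rule tendsto_imp_filterlim_at_right[OF lim_right])
  show "eventually (\<lambda>y. 0 < f y) (at_right c)"
    using eventually_at_right_real[OF c_bounds(2)]
    by eventually_elim (use c_bounds in \<open>auto intro!: greater_zero\<close>)
qed

lemma f_at_left_c: "filterlim f (at_left 1) (at_left c)"
proof (rule tendsto_imp_filterlim_at_left[OF lim_left])
  show "eventually (\<lambda>y. f y < 1) (at_left c)"
    using eventually_at_left_real[OF c_bounds(1)]
    by eventually_elim (use c_bounds in \<open>auto intro!: less_one\<close>)
qed

section \<open>The doubled space\<close>

abbreviation "A \<equiv> doubled_pts f c"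
abbreviation "X \<equiv> doubled_space f c"
abbreviation "h \<equiv> fhat f c"

lemma c_in_A: "c \<in> A"
  using c_bounds by (auto simp: doubled_pts_def intro: exI[of _ 0])

lemma A_bounds: "a \<in> A \<Longrightarrow> 0 < a \<and> a < 1"
  by (auto simp: doubled_pts_def less_le)

text \<open>The hitting time of \<open>c\<close> shifts by one. The points \<open>0\<close> and
  \<open>1\<close> are excluded because they can map into \<open>A\<close> without lying in it,
  whence their clauses in \<open>fhat\<close>.\<close>

lemma f_in_A_iff:
  assumes "0 < a" "a < 1" "a \<noteq> c"
  shows "f a \<in> A \<longleftrightarrow> a \<in> A"
proof -
  have "f a \<in> {0..1} - {0, 1}"
    using less_one[of a] greater_zero[of a] assms by auto
  moreover have "(\<exists>n. (f ^^ n) (f a) = c) \<longleftrightarrow> (\<exists>n. (f ^^ n) a = c)"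
    using assms(3) by (metis funpow_0 funpow_Suc_right not0_implies_Suc o_apply)
  ultimately show ?thesis
    using assms by (auto simp: doubled_pts_def)
qed

lemma in_X_iff [simp]:
  "Pt x \<in> X \<longleftrightarrow> x \<in> {0..1} \<and> x \<notin> A" "Minus x \<in> X \<longleftrightarrow> x \<in> A" "Plus x \<in> X \<longleftrightarrow> x \<in> A"
  by (auto simp: doubled_space_def)

lemma proj_unit: "p \<in> X \<Longrightarrow> proj p \<in> {0..1}"
  using A_bounds by (cases p) (auto simp: less_imp_le)

lemma fhat_closed:
  assumes "p \<in> X"
  shows "h p \<in> X"
proof (cases p)
  case (Pt x)
  then have "x \<in> {0..1}" "x \<notin> A" "x \<noteq> c"
    using assms c_in_A by auto
  then show ?thesis
    using Pt maps_unit[of x] f_in_A_iff[of x] by (cases "x = 0 \<or> x = 1") auto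
qed (use assms A_bounds f_in_A_iff in \<open>auto simp: doubled_pts_def\<close>)

lemma funpow_fhat_closed: "p \<in> X \<Longrightarrow> (h ^^ n) p \<in> X"
  by (induction n) (use fhat_closed in auto)

text \<open>\<open>Pt 0\<close> and \<open>Pt 1\<close> come from the copies of \<open>c\<close>;
  any other \<open>p\<close> comes from the copy of the same kind over a preimage under
  \<open>f\<close>.\<close>

lemma fhat_surj:
  assumes "p \<in> X"
  shows "p \<in> h ` X"
proof -
  consider "p = Pt 0" | "p = Pt 1" | "0 < proj p" "proj p < 1"
    using assms A_bounds by (cases p) (auto simp: less_le)
  then show ?thesis
  proof cases
    case 1
    then show ?thesis using c_in_A by (intro image_eqI[of _ _ "Plus c"]) auto
  next
    case 2
    then show ?thesis using c_in_A by (intro image_eqI[of _ _ "Minus c"]) auto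
  next
    case 3
    then obtain x where x: "0 < x" "x < 1" "x \<noteq> c" "f x = proj p"
      using interior_preimage by blast
    show ?thesis
    proof (cases p)
      case (Pt y)
      then show ?thesis
        using x assms f_in_A_iff[of x] by (intro image_eqI[of _ _ "Pt x"]) auto
    next
      case (Minus y)
      then show ?thesis
        using x assms f_in_A_iff[of x] by (intro image_eqI[of _ _ "Minus x"]) auto
    next
      case (Plus y)
      then show ?thesis
        using x assms f_in_A_iff[of x] by (intro image_eqI[of _ _ "Plus x"]) auto
    qed
  qed
qed

section \<open>Projections of lifted orbits\<close>

lemma proj_fhat: "proj p \<noteq> c \<Longrightarrow> proj (h p) = f (proj p)"
  by (cases p) auto

lemma proj_funpow_fhat:
  assumes "\<And>j. j < n \<Longrightarrow> (f ^^ j) (proj p) \<noteq> c"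
  shows "proj ((h ^^ n) p) = (f ^^ n) (proj p)"
  using assms by (induction n) (auto simp: proj_fhat)

text \<open>Here the avoidance of \<open>c\<close> is read off the lifted orbit, as suits a first
  hitting time of that orbit.\<close>

lemma proj_funpow_fhat':
  assumes "\<And>j. j < n \<Longrightarrow> proj ((h ^^ j) p) \<noteq> c"
  shows "proj ((h ^^ n) p) = (f ^^ n) (proj p)"
  using assms
proof (induction n)
  case (Suc n)
  then show ?case
    using proj_fhat[of "(h ^^ n) p"] by auto
qed simp

text \<open>The points at which the lifted map follows right-hand limits of \<open>f\<close>; an
  undoubled point of \<open>(0, 1)\<close> belongs to \<open>left_pts\<close> as well.\<close>

definition right_pts :: "dpoint set" where
  "right_pts = {p \<in> X. proj p < 1 \<and> (\<forall>a. p \<noteq> Minus a)}"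

definition left_pts :: "dpoint set" where
  "left_pts = {p \<in> X. 0 < proj p \<and> (\<forall>a. p \<noteq> Plus a)}"

text \<open>Invariance and the limit come together so that they can be iterated; the jump enters at
  \<open>Plus c\<close>.\<close>

lemma fhat_right_pts:
  assumes "p \<in> right_pts"
  shows "h p \<in> right_pts \<and> filterlim f (at_right (proj (h p))) (at_right (proj p))"
proof (cases p)
  case (Pt x)
  then have x: "0 \<le> x" "x < 1" "x \<noteq> c" "x \<notin> A"
    using assms c_in_A by (auto simp: right_pts_def)
  then have "proj (h p) = f x" "f x < 1" "\<forall>a. h p \<noteq> Minus a"
    using Pt less_one by auto
  then show ?thesis
    using Pt fhat_closed[of p] assms f_at_right[of x] x by (auto simp: right_pts_def)
next
  case (Plus a)
  then have "a \<in> A" "0 < a" "a < 1"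
    using assms A_bounds by (auto simp: right_pts_def)
  then show ?thesis
    using Plus fhat_closed[of p] f_at_right[of a] f_at_right_c less_one[of a]
    by (auto simp: right_pts_def)
qed (use assms in \<open>simp add: right_pts_def\<close>)

lemma fhat_left_pts:
  assumes "p \<in> left_pts"
  shows "h p \<in> left_pts \<and> filterlim f (at_left (proj (h p))) (at_left (proj p))"
proof (cases p)
  case (Pt x)
  then have x: "0 < x" "x \<le> 1" "x \<noteq> c" "x \<notin> A"
    using assms c_in_A by (auto simp: left_pts_def)
  then have "proj (h p) = f x" "0 < f x" "\<forall>a. h p \<noteq> Plus a"
    using Pt greater_zero by auto
  then show ?thesis
    using Pt fhat_closed[of p] assms f_at_left[of x] x by (auto simp: left_pts_def)
next
  case (Minus a)
  then have "a \<in> A" "0 < a" "a < 1"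
    using assms A_bounds by (auto simp: left_pts_def)
  then show ?thesis
    using Minus fhat_closed[of p] f_at_left[of a] f_at_left_c greater_zero[of a]
    by (auto simp: left_pts_def)
qed (use assms in \<open>simp add: left_pts_def\<close>)

text \<open>Composing the limits shows that a lifted iterate projects to a one-sided limit of
  \<open>f ^^ n\<close>, even when the orbit passes through \<open>c\<close>.\<close>

lemma funpow_right_pts:
  assumes "p \<in> right_pts"
  shows "(h ^^ n) p \<in> right_pts \<and> filterlim (f ^^ n) (at_right (proj ((h ^^ n) p))) (at_right (proj p))"
proof (induction n)
  case 0
  then show ?case using assms by (simp add: filterlim_ident id_def)
next
  case (Suc n)
  then show ?case
    using fhat_right_pts[of "(h ^^ n) p"] filterlim_compose[of f _ _ "f ^^ n"] by (auto simp: o_def)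
qed

lemma funpow_left_pts:
  assumes "p \<in> left_pts"
  shows "(h ^^ n) p \<in> left_pts \<and> filterlim (f ^^ n) (at_left (proj ((h ^^ n) p))) (at_left (proj p))"
proof (induction n)
  case 0
  then show ?case using assms by (simp add: filterlim_ident id_def)
next
  case (Suc n)
  then show ?case
    using fhat_left_pts[of "(h ^^ n) p"] filterlim_compose[of f _ _ "f ^^ n"] by (auto simp: o_def)
qed

text \<open>
  The orbit of \<open>proj p\<close> may hit \<open>c\<close> here: \<open>f\<^sup>n\<close> can be continuous at a preimage of \<open>c\<close> if the orbits
  of \<open>0\<close> and \<open>1\<close> merge.
\<close>

lemma proj_funpow_fhat_isCont:
  assumes "p \<in> X" "0 < proj p" "proj p < 1" "isCont (f ^^ n) (proj p)"
  shows "proj ((h ^^ n) p) = (f ^^ n) (proj p)"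
proof -
  have lim: "(f ^^ n \<longlongrightarrow> (f ^^ n) (proj p)) (at (proj p))"
    using assms(4) by (simp add: isCont_def)
  \<comment> \<open>An interior point can be followed from at least one side, and continuity equates
    that one-sided limit with the value.\<close>
  consider "p \<in> right_pts" | "p \<in> left_pts"
    using assms(1-3) by (cases p) (auto simp: right_pts_def left_pts_def)
  then show ?thesis
  proof cases
    case 1
    then have "(f ^^ n \<longlongrightarrow> proj ((h ^^ n) p)) (at_right (proj p))"
      using funpow_right_pts[of p n] by (auto simp: filterlim_at)
    then show ?thesis
      using lim by (intro tendsto_unique[OF trivial_limit_at_right_real])
        (auto intro: tendsto_within_subset)
  next
    case 2
    then have "(f ^^ n \<longlongrightarrow> proj ((h ^^ n) p)) (at_left (proj p))"
      using funpow_left_pts[of p n] by (auto simp: filterlim_at)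
    then show ?thesis
      using lim by (intro tendsto_unique[OF trivial_limit_at_left_real])
        (auto intro: tendsto_within_subset)
  qed
qed

text \<open>The clause of \<open>dless\<close> for two copies of one point needs a left copy as
  lower or a right copy as upper point, which \<open>p\<close> and \<open>q\<close> are not.\<close>

lemma dinterval_eq:
  assumes "p \<in> right_pts" "q \<in> left_pts"
  shows "dinterval f c p q = {x \<in> X. proj p < proj x \<and> proj x < proj q}"
  using assms by (auto simp: dinterval_def dless_def right_pts_def left_pts_def)

text \<open>Both orbits visit the same points up to the first passage through \<open>c\<close>.\<close>

lemma orbit_meets_iff:
  assumes "c \<in> {u<..<v}"
  shows "(\<exists>n. proj ((h ^^ n) p) \<in> {u<..<v}) \<longleftrightarrow> Orb f (proj p) \<inter> {u<..<v} \<noteq> {}"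
proof
  assume "\<exists>n. proj ((h ^^ n) p) \<in> {u<..<v}"
  then obtain n where n: "proj ((h ^^ n) p) \<in> {u<..<v}"
    "\<And>j. j < n \<Longrightarrow> proj ((h ^^ j) p) \<notin> {u<..<v}"
    using exists_least_iff[of "\<lambda>n. proj ((h ^^ n) p) \<in> {u<..<v}"] by blast
  \<comment> \<open>Before its first hit the orbit misses \<open>(u, v)\<close> and hence
    \<open>c\<close>.\<close>
  then have "proj ((h ^^ n) p) = (f ^^ n) (proj p)"
    using assms by (intro proj_funpow_fhat') metis
  then show "Orb f (proj p) \<inter> {u<..<v} \<noteq> {}"
    using n(1) by (auto simp: Orb_def)
next
  assume "Orb f (proj p) \<inter> {u<..<v} \<noteq> {}"
  then have "\<exists>n. (f ^^ n) (proj p) \<in> {u<..<v}"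
    by (auto simp: Orb_def)
  then obtain n where n: "(f ^^ n) (proj p) \<in> {u<..<v}"
    "\<And>j. j < n \<Longrightarrow> (f ^^ j) (proj p) \<notin> {u<..<v}"
    using exists_least_iff[of "\<lambda>n. (f ^^ n) (proj p) \<in> {u<..<v}"] by blast
  then have "proj ((h ^^ n) p) = (f ^^ n) (proj p)"
    using assms by (intro proj_funpow_fhat) metis
  then show "\<exists>n. proj ((h ^^ n) p) \<in> {u<..<v}"
    using n(1) by metis
qed

end

lemma Orb_funpow: "Orb f ((f ^^ n) x) \<subseteq> Orb f x"
proof
  fix y assume "y \<in> Orb f ((f ^^ n) x)"
  then obtain i where "y = (f ^^ (i + n)) x"
    by (auto simp: Orb_def funpow_add)
  then show "y \<in> Orb f x"
    by (auto simp: Orb_def)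
qed

lemma Orb_refl: "x \<in> Orb f x"
  by (auto simp: Orb_def intro: exI[of _ 0])

section \<open>Renormalizations\<close>

text \<open>The affine chart \<open>s\<close> from \<open>[u, v]\<close> to \<open>[0, 1]\<close>
  transports the facts on Lorenz maps to \<open>g\<close>.\<close>

lemma lorenz_on_properties:
  assumes "lorenz_on u v g c"
  shows "u < c" "c < v" "(g \<longlongrightarrow> v) (at_left c)" "(g \<longlongrightarrow> u) (at_right c)"
    and "\<And>x. x \<in> {u<..<v} - {c} \<Longrightarrow> isCont g x \<and> u < g x \<and> g x < v"
proof -
  define G where "G t = (g (u + (v - u) * t) - u) / (v - u)" for t
  define s where "s x = (x - u) / (v - u)" for x
  have uv: "u < v"
    using assms by (simp add: lorenz_on_def)
  interpret G: lorenz_map G "s c"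
    using assms by unfold_locales (simp add: lorenz_on_def G_def[abs_def] s_def)
  have g: "g x = u + (v - u) * G (s x)" for x
    using uv by (simp add: G_def s_def)
  show c: "u < c" "c < v"
    using G.c_bounds uv by (simp_all add: s_def zero_less_divide_iff divide_less_eq)
  have s_less: "s x < s y \<longleftrightarrow> x < y" for x y
    using uv by (simp add: s_def divide_less_cancel)
  have s_lim: "(s \<longlongrightarrow> s c) F" if "(id \<longlongrightarrow> c) F" for F
    using that uv unfolding s_def id_def by (intro tendsto_intros) auto
  have "filterlim s (at_left (s c)) (at_left c)"
    by (intro tendsto_imp_filterlim_at_left s_lim)
      (auto simp: s_less id_def eventually_at_filter)
  then have "((\<lambda>x. G (s x)) \<longlongrightarrow> 1) (at_left c)"
    by (rule filterlim_compose[OF G.lim_left])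
  then have "((\<lambda>x. u + (v - u) * G (s x)) \<longlongrightarrow> u + (v - u) * 1) (at_left c)"
    by (intro tendsto_intros)
  then show "(g \<longlongrightarrow> v) (at_left c)"
    by (simp add: g[abs_def])
  have "filterlim s (at_right (s c)) (at_right c)"
    by (intro tendsto_imp_filterlim_at_right s_lim)
      (auto simp: s_less id_def eventually_at_filter)
  then have "((\<lambda>x. G (s x)) \<longlongrightarrow> 0) (at_right c)"
    by (rule filterlim_compose[OF G.lim_right])
  then have "((\<lambda>x. u + (v - u) * G (s x)) \<longlongrightarrow> u + (v - u) * 0) (at_right c)"
    by (intro tendsto_intros)
  then show "(g \<longlongrightarrow> u) (at_right c)"
    by (simp add: g[abs_def])
  fix x assume x: "x \<in> {u<..<v} - {c}"
  then have s: "0 < s x" "s x < 1" "s x \<noteq> s c"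
    using uv by (auto simp: s_def)
  have "isCont s x"
    using uv unfolding s_def[abs_def] by (intro continuous_intros) auto
  moreover have "isCont G (s x)"
    using s continuous_on_interior[OF G.cont_left, of "s x"] continuous_on_interior[OF G.cont_right, of "s x"]
    by (cases "s x < s c") auto
  ultimately have "isCont (\<lambda>x. G (s x)) x"
    by (rule isCont_o2)
  then have "isCont (\<lambda>x. u + (v - u) * G (s x)) x"
    by (intro continuous_intros)
  moreover have "0 < (v - u) * G (s x)" "(v - u) * G (s x) < (v - u) * 1"
    using G.greater_zero[of "s x"] G.less_one[of "s x"] s uv by (auto intro: mult_strict_left_mono)
  ultimately show "isCont g x \<and> u < g x \<and> g x < v"
    unfolding g[abs_def] by auto
qed

locale lorenz_renorm = lorenz_map +
  fixes g :: "real \<Rightarrow> real" and m k :: nat and u v :: real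
  assumes renorm: "renormalization f c m k g"
    and u_eq: "u = iter_right f k c" and v_eq: "v = iter_left f m c"
begin

lemma renorm_properties:
  shows "0 < m" "0 < k" "0 \<le> u" "u < c" "c < v" "v \<le> 1"
    and "(f ^^ m \<longlongrightarrow> v) (at_left c)" "(f ^^ k \<longlongrightarrow> u) (at_right c)"
    and "\<And>x. x \<in> {u<..<c} \<Longrightarrow> isCont (f ^^ m) x \<and> (f ^^ m) x \<in> {u<..<v}"
    and "\<And>x. x \<in> {c<..<v} \<Longrightarrow> isCont (f ^^ k) x \<and> (f ^^ k) x \<in> {u<..<v}"
proof -
  obtain u' v' where mk: "m > 1" "k > 1"
    and sub: "{u'<..<v'} \<subset> {0<..<1}"
    and gl: "\<And>x. x \<in> {u'<..<c} \<Longrightarrow> g x = (f ^^ m) x"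
    and gr: "\<And>x. x \<in> {c<..<v'} \<Longrightarrow> g x = (f ^^ k) x"
    and L: "lorenz_on u' v' g c"
    using renorm unfolding renormalization_def by blast
  note P = lorenz_on_properties[OF L]
  have ev_l: "eventually (\<lambda>x. g x = (f ^^ m) x) (at_left c)"
    using eventually_at_left_real[OF P(1)] by eventually_elim (use gl in auto)
  have ev_r: "eventually (\<lambda>x. g x = (f ^^ k) x) (at_right c)"
    using eventually_at_right_real[OF P(2)] by eventually_elim (use gr in auto)
  have lim_l: "(f ^^ m \<longlongrightarrow> v') (at_left c)"
    using P(3) by (rule Lim_transform_eventually[OF _ ev_l])
  have lim_r: "(f ^^ k \<longlongrightarrow> u') (at_right c)"
    using P(4) by (rule Lim_transform_eventually[OF _ ev_r])
  \<comment> \<open>The ends of the interval in the definition are one-sided limits at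
    \<open>c\<close>; uniqueness of limits identifies them with \<open>u\<close> and
    \<open>v\<close>.\<close>
  have v: "v' = v"
    unfolding v_eq iter_left_def using lim_l by (intro tendsto_Lim[symmetric]) auto
  have u: "u' = u"
    unfolding u_eq iter_right_def using lim_r by (intro tendsto_Lim[symmetric]) auto
  show "0 < m" "0 < k" "u < c" "c < v"
    using mk P(1,2) u v by auto
  show "0 \<le> u" "v \<le> 1"
    using sub P(1,2) unfolding u v
    by (auto dest!: psubset_imp_subset simp: greaterThanLessThan_subseteq_greaterThanLessThan)
  show "(f ^^ m \<longlongrightarrow> v) (at_left c)" "(f ^^ k \<longlongrightarrow> u) (at_right c)"
    using lim_l lim_r u v by auto
  show "isCont (f ^^ m) x \<and> (f ^^ m) x \<in> {u<..<v}" if "x \<in> {u<..<c}" for x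
  proof -
    \<comment> \<open>Transferring continuity from \<open>g\<close> needs agreement on a whole
      neighbourhood of \<open>x\<close>.\<close>
    have "eventually (\<lambda>y. g y = (f ^^ m) y) (nhds x)"
      using eventually_nhds_in_open[of "{u<..<c}" x] that
      by (auto elim!: eventually_mono intro: gl simp: u)
    then show ?thesis
      using P(5)[of x] that gl[of x] isCont_cong[of g "f ^^ m" x] P(2) by (auto simp: u v)
  qed
  show "isCont (f ^^ k) x \<and> (f ^^ k) x \<in> {u<..<v}" if "x \<in> {c<..<v}" for x
  proof -
    have "eventually (\<lambda>y. g y = (f ^^ k) y) (nhds x)"
      using eventually_nhds_in_open[of "{c<..<v}" x] that
      by (auto elim!: eventually_mono intro: gr simp: v)
    then show ?thesis
      using P(5)[of x] that gr[of x] isCont_cong[of g "f ^^ k" x] P(1) by (auto simp: u v)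
  qed
qed

section \<open>The lifted renormalization interval and complete invariance\<close>

definition uh :: dpoint where "uh = (h ^^ k) (Plus c)"
definition vh :: dpoint where "vh = (h ^^ m) (Minus c)"
abbreviation "J \<equiv> dinterval f c uh vh"
abbreviation "E \<equiv> Fhat f c uh vh"

lemma uh: "uh \<in> right_pts" "proj uh = u"
proof -
  have "Plus c \<in> right_pts"
    using c_in_A c_bounds by (auto simp: right_pts_def)
  then have *: "uh \<in> right_pts" "(f ^^ k \<longlongrightarrow> proj uh) (at_right c)"
    using funpow_right_pts[of "Plus c" k] by (auto simp: filterlim_at uh_def)
  then show "uh \<in> right_pts" "proj uh = u"
    using tendsto_unique[OF trivial_limit_at_right_real *(2) renorm_properties(8)] by auto
qed

lemma vh: "vh \<in> left_pts" "proj vh = v"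
proof -
  have "Minus c \<in> left_pts"
    using c_in_A c_bounds by (auto simp: left_pts_def)
  then have *: "vh \<in> left_pts" "(f ^^ m \<longlongrightarrow> proj vh) (at_left c)"
    using funpow_left_pts[of "Minus c" m] by (auto simp: filterlim_at vh_def)
  then show "vh \<in> left_pts" "proj vh = v"
    using tendsto_unique[OF trivial_limit_at_left_real *(2) renorm_properties(7)] by auto
qed

lemma c_mem: "c \<in> {u<..<v}"
  using renorm_properties(4,5) by simp

lemma J_eq: "J = {p \<in> X. proj p \<in> {u<..<v}}"
  using dinterval_eq[OF uh(1) vh(1)] uh(2) vh(2) by simp

lemma E_iff_hits: "p \<in> E \<longleftrightarrow> p \<in> X \<and> (\<exists>n. proj ((h ^^ n) p) \<in> {u<..<v})"
  using funpow_fhat_closed[of p] by (auto simp: Fhat_def Orb_def J_eq)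

lemma E_iff: "p \<in> E \<longleftrightarrow> p \<in> X \<and> Orb f (proj p) \<inter> {u<..<v} \<noteq> {}"
  unfolding E_iff_hits orbit_meets_iff[OF c_mem] ..

lemma J_subset_E: "J \<subseteq> E"
  using Orb_refl[of _ f] by (fastforce simp: E_iff J_eq)

lemma E_backward:
  assumes "p \<in> X" "(h ^^ n) p \<in> E"
  shows "p \<in> E"
proof -
  obtain i where "proj ((h ^^ i) ((h ^^ n) p)) \<in> {u<..<v}"
    using assms(2) by (auto simp: E_iff_hits)
  then have "proj ((h ^^ (i + n)) p) \<in> {u<..<v}"
    by (simp add: funpow_add)
  then show ?thesis
    using assms(1) E_iff_hits by blast
qed

lemma c_copies_in_J: "Minus c \<in> J" "Plus c \<in> J"
  using c_in_A c_mem by (auto simp: J_eq)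

text \<open>Membership in \<open>E\<close> always pulls back, and surjectivity of \<open>h\<close>
  then puts \<open>E\<close> inside its own image. Going forward, a point whose orbit hits at a
  positive time stays in \<open>E\<close>; a hit at time 0 means that the point lies in
  \<open>J\<close>.\<close>

lemma completely_invariant_iff_image_J: "completely_invariant X h E \<longleftrightarrow> h ` J \<subseteq> E"
proof
  assume "completely_invariant X h E"
  then show "h ` J \<subseteq> E"
    using J_subset_E by (auto simp: completely_invariant_def)
next
  assume J: "h ` J \<subseteq> E"
  have EX: "E \<subseteq> X"
    by (auto simp: E_iff)
  have fwd: "h p \<in> E" if p: "p \<in> E" for p
  proof -
    obtain n where n: "proj ((h ^^ n) p) \<in> {u<..<v}"
      using p by (auto simp: E_iff_hits)
    show ?thesis
    proof (cases n)
      case 0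
      then show ?thesis
        using n p J EX by (auto simp: J_eq)
    next
      case (Suc i)
      then have "proj ((h ^^ i) (h p)) \<in> {u<..<v}"
        using n by (simp add: funpow_swap1)
      then show ?thesis
        using p EX fhat_closed by (auto simp: E_iff_hits)
    qed
  qed
  have bwd: "p \<in> E" if "p \<in> X" "h p \<in> E" for p
    using E_backward[of p 1] that by simp
  have "E \<subseteq> h ` E"
  proof
    fix p assume p: "p \<in> E"
    then obtain q where "q \<in> X" "h q = p"
      using EX fhat_surj by blast
    then show "p \<in> h ` E"
      using p bwd by blast
  qed
  then show "completely_invariant X h E"
    unfolding completely_invariant_def using fwd bwd EX c_copies_in_J J_subset_E by blast
qed

text \<open>\<open>f ^^ m\<close> is continuous at \<open>proj p\<close>, so the lifted iterate
  projects to its value even if the orbit meets \<open>c\<close> on the way.\<close>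

lemma return_left:
  assumes "p \<in> J" "proj p < c"
  shows "(h ^^ m) p \<in> J"
proof -
  have "isCont (f ^^ m) (proj p) \<and> (f ^^ m) (proj p) \<in> {u<..<v}"
    using assms by (intro renorm_properties(9)) (auto simp: J_eq)
  then show ?thesis
    using assms proj_funpow_fhat_isCont[of p m] funpow_fhat_closed[of p m] renorm_properties(3,6)
    by (auto simp: J_eq)
qed

lemma return_right:
  assumes "p \<in> J" "c < proj p"
  shows "(h ^^ k) p \<in> J"
proof -
  have "isCont (f ^^ k) (proj p) \<and> (f ^^ k) (proj p) \<in> {u<..<v}"
    using assms by (intro renorm_properties(10)) (auto simp: J_eq)
  then show ?thesis
    using assms proj_funpow_fhat_isCont[of p k] funpow_fhat_closed[of p k] renorm_properties(3,6)
    by (auto simp: J_eq)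
qed

text \<open>The copies of \<open>c\<close> move to \<open>vh\<close> and \<open>uh\<close> while the
  other points of \<open>J\<close> return to \<open>J\<close>, so everything depends on whether
  \<open>uh\<close> and \<open>vh\<close> lie in \<open>E\<close>.\<close>

lemma completely_invariant_iff:
  "completely_invariant X h E \<longleftrightarrow> Orb f u \<inter> {u<..<v} \<noteq> {} \<and> Orb f v \<inter> {u<..<v} \<noteq> {}"
proof -
  have ends: "uh \<in> E \<longleftrightarrow> Orb f u \<inter> {u<..<v} \<noteq> {}" "vh \<in> E \<longleftrightarrow> Orb f v \<inter> {u<..<v} \<noteq> {}"
    using uh vh by (auto simp: E_iff right_pts_def left_pts_def)
  have "uh \<in> E \<and> vh \<in> E" if inv: "completely_invariant X h E"
  proof -
    have "(h ^^ n) p \<in> E" if "p \<in> E" for n p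
      by (induction n) (use that inv in \<open>auto simp: completely_invariant_def\<close>)
    then show ?thesis
      using c_copies_in_J J_subset_E by (auto simp: uh_def vh_def)
  qed
  moreover have "h p \<in> E" if ends: "uh \<in> E" "vh \<in> E" and p: "p \<in> J" for p
  proof -
    have "p \<in> X"
      using p by (simp add: J_eq)
    \<comment> \<open>Positivity of \<open>n\<close> matters: the hit must still lie ahead of
      \<open>h p\<close>.\<close>
    have "\<exists>n>0. (h ^^ n) p \<in> E"
    proof (cases "proj p" c rule: linorder_cases)
      case less
      then show ?thesis
        using return_left[OF p] J_subset_E renorm_properties(1) by blast
    next
      case greater
      then show ?thesis
        using return_right[OF p] J_subset_E renorm_properties(2) by blast
    next
      case equal
      then have "p = Minus c \<or> p = Plus c"
        using \<open>p \<in> X\<close> c_in_A by (cases p) auto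
      then show ?thesis
        using ends renorm_properties(1,2) unfolding uh_def vh_def by blast
    qed
    then obtain n where "(h ^^ Suc n) p \<in> E"
      by (metis gr0_conv_Suc)
    then have "(h ^^ n) (h p) \<in> E"
      by (simp add: funpow_swap1)
    then show ?thesis
      using E_backward fhat_closed \<open>p \<in> X\<close> by blast
  qed
  ultimately show ?thesis
    unfolding ends(1,2)[symmetric] completely_invariant_iff_image_J by blast
qed

section \<open>Behaviour at the ends and the remaining claims\<close>

text \<open>One step takes \<open>Plus c\<close> to \<open>Pt 0\<close>, which is then
  fixed.\<close>

lemma u_zero:
  assumes "f 0 = 0"
  shows "u = 0"
proof -
  have "0 \<notin> A"
    by (simp add: doubled_pts_def)
  then have "(h ^^ n) (Pt 0) = Pt 0" for n
    using assms by (induction n) auto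
  moreover have "(h ^^ k) (Plus c) = (h ^^ (k - 1)) (h (Plus c))"
    using renorm_properties(2) by (cases k) (auto simp: funpow_swap1)
  ultimately have "uh = Pt 0"
    by (simp add: uh_def)
  then show ?thesis
    using uh(2) by simp
qed

lemma v_one:
  assumes "f 1 = 1"
  shows "v = 1"
proof -
  have "1 \<notin> A"
    by (simp add: doubled_pts_def)
  then have "(h ^^ n) (Pt 1) = Pt 1" for n
    using assms by (induction n) auto
  moreover have "(h ^^ m) (Minus c) = (h ^^ (m - 1)) (h (Minus c))"
    using renorm_properties(1) by (cases m) (auto simp: funpow_swap1)
  ultimately have "vh = Pt 1"
    by (simp add: vh_def)
  then show ?thesis
    using vh(2) by simp
qed

text \<open>If \<open>f 0 = 0\<close>, then \<open>u = 0\<close> and its orbit never meets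
  \<open>(u, v)\<close>. The alternative \<open>0 < u\<close> is what a point of
  \<open>[0, u)\<close> provides.\<close>

lemma f_0_pos:
  assumes "0 < u \<or> completely_invariant X h E"
  shows "0 < f 0"
proof (rule ccontr)
  assume "\<not> 0 < f 0"
  then have f0: "f 0 = 0"
    using maps_unit[of 0] by simp
  then have "(f ^^ n) 0 = 0" for n
    by (induction n) auto
  then have "Orb f u = {0}"
    using u_zero[OF f0] by (auto simp: Orb_def)
  then show False
    using assms u_zero[OF f0] completely_invariant_iff by auto
qed

lemma f_1_less:
  assumes "v < 1 \<or> completely_invariant X h E"
  shows "f 1 < 1"
proof (rule ccontr)
  assume "\<not> f 1 < 1"
  then have f1: "f 1 = 1"
    using maps_unit[of 1] by simp
  then have "(f ^^ n) 1 = 1" for n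
    by (induction n) auto
  then have "Orb f v = {1}"
    using v_one[OF f1] by (auto simp: Orb_def)
  then show False
    using assms v_one[OF f1] completely_invariant_iff by auto
qed

lemma orbit_exceeds_u:
  assumes "x \<in> {0..<u}"
  shows "Orb f x \<inter> {u<..1} \<noteq> {}"
proof -
  obtain n where "(f ^^ n) x > u"
    using orbit_climbs[of x u] f_0_pos assms renorm_properties(4) by auto
  moreover have "(f ^^ n) x \<le> 1"
    using funpow_unit[of x n] assms renorm_properties(4) c_bounds by auto
  ultimately show ?thesis
    by (auto simp: Orb_def)
qed

lemma orbit_falls_below_v:
  assumes "y \<in> {v<..1}"
  shows "Orb f y \<inter> {0..<v} \<noteq> {}"
proof -
  obtain n where "(f ^^ n) y < v"
    using orbit_descends[of y v] f_1_less assms renorm_properties(5) by auto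
  moreover have "0 \<le> (f ^^ n) y"
    using funpow_unit[of y n] assms renorm_properties(5) c_bounds by auto
  ultimately show ?thesis
    by (auto simp: Orb_def)
qed

lemma Orb_meets_shift: "Orb f ((f ^^ n) x) \<inter> {u<..<v} \<noteq> {} \<Longrightarrow> Orb f x \<inter> {u<..<v} \<noteq> {}"
  using Orb_funpow[of f n x] by blast

text \<open>An orbit climbing out of \<open>[0, u]\<close> cannot jump over the interval, since its
  last step lands at most at \<open>f u < v\<close>. Every orbit gets below \<open>v\<close>
  first.\<close>

lemma all_orbits_meet_left:
  assumes f: "0 < f 0" "f 1 < 1" and fu: "f u \<in> {u<..<v}" and x: "x \<in> {0..1}"
  shows "Orb f x \<inter> {u<..<v} \<noteq> {}"
proof -
  have low: "Orb f y \<inter> {u<..<v} \<noteq> {}" if y: "0 \<le> y" "y < v" for y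
  proof (cases "u < y")
    case True
    then show ?thesis
      using y Orb_refl[of y f] by auto
  next
    case False
    obtain n where n: "(f ^^ n) y > u" "\<And>j. j < n \<Longrightarrow> 0 \<le> (f ^^ j) y \<and> (f ^^ j) y \<le> u"
      using orbit_climbs[OF f(1) y(1) renorm_properties(4)] by blast
    \<comment> \<open>As \<open>y\<close> itself is at most \<open>u\<close>, the exit takes at
      least one step and has a predecessor in \<open>[0, u]\<close>.\<close>
    then obtain i where i: "n = Suc i"
      using False by (cases n) auto
    then have "(f ^^ n) y \<le> f u"
      using n(2)[of i] strict_mono_on_leD[OF mono_left, of "(f ^^ i) y" u] renorm_properties(3,4) by auto
    then have "(f ^^ n) y \<in> {u<..<v}"
      using n(1) fu by auto
    then show ?thesis
      by (auto simp: Orb_def)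
  qed
  obtain n where "(f ^^ n) x < v"
    using orbit_descends[OF f(2) _ renorm_properties(5), of x] x by auto
  then show ?thesis
    using low[of "(f ^^ n) x"] funpow_unit[OF x, of n] Orb_meets_shift by auto
qed

text \<open>Mirror image: the last step out of \<open>[v, 1]\<close> lands at least at
  \<open>f v > u\<close>.\<close>

lemma all_orbits_meet_right:
  assumes f: "0 < f 0" "f 1 < 1" and fv: "f v \<in> {u<..<v}" and x: "x \<in> {0..1}"
  shows "Orb f x \<inter> {u<..<v} \<noteq> {}"
proof -
  have high: "Orb f y \<inter> {u<..<v} \<noteq> {}" if y: "y \<le> 1" "u < y" for y
  proof (cases "y < v")
    case True
    then show ?thesis
      using y Orb_refl[of y f] by auto
  next
    case False
    obtain n where n: "(f ^^ n) y < v" "\<And>j. j < n \<Longrightarrow> (f ^^ j) y \<le> 1 \<and> v \<le> (f ^^ j) y"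
      using orbit_descends[OF f(2) y(1) renorm_properties(5)] by blast
    then obtain i where i: "n = Suc i"
      using False by (cases n) auto
    then have "f v \<le> (f ^^ n) y"
      using n(2)[of i] strict_mono_on_leD[OF mono_right, of v "(f ^^ i) y"] renorm_properties(5,6) by auto
    then have "(f ^^ n) y \<in> {u<..<v}"
      using n(1) fv by auto
    then show ?thesis
      by (auto simp: Orb_def)
  qed
  obtain n where "(f ^^ n) x > u"
    using orbit_climbs[OF f(1) _ renorm_properties(4), of x] x by auto
  then show ?thesis
    using high[of "(f ^^ n) x"] funpow_unit[OF x, of n] Orb_meets_shift by auto
qed

lemma E_eq_X:
  assumes "completely_invariant X h E" "f u \<in> {u<..<v} \<or> f v \<in> {u<..<v}"
  shows "E = X"
  using all_orbits_meet_left all_orbits_meet_right f_0_pos f_1_less assms proj_unit E_iff by blast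

lemma images_of_J_subset:
  assumes "completely_invariant X h E"
  shows "(\<Union>n. (h ^^ n) ` J) \<subseteq> E"
proof -
  have "(h ^^ n) p \<in> E" if "p \<in> J" for n p
    by (induction n) (use that J_subset_E assms in \<open>auto simp: completely_invariant_def\<close>)
  then show ?thesis by blast
qed

end

theorem lemma2p9:
  fixes f g :: "real \<Rightarrow> real" and c u v :: real and m k :: nat
    and uh vh :: dpoint and Fg :: "dpoint set"
  assumes "expanding_lorenz f c"
    and "renormalization f c m k g"
    and "u = iter_right f k c" and "v = iter_left f m c"
    and "uh = (fhat f c ^^ k) (Plus c)" and "vh = (fhat f c ^^ m) (Minus c)"
    and "Fg = Fhat f c uh vh"
  shows "(completely_invariant (doubled_space f c) (fhat f c) Fg \<longleftrightarrow>
            Orb f u \<inter> {u<..<v} \<noteq> {} \<and> Orb f v \<inter> {u<..<v} \<noteq> {}) \<and>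
         (completely_invariant (doubled_space f c) (fhat f c) Fg \<longrightarrow>
            (\<Union>n. (fhat f c ^^ n) ` dinterval f c uh vh) \<subseteq> Fg \<and>
            (\<forall>x\<in>{0..<u}. Orb f x \<inter> {u<..1} \<noteq> {}) \<and>
            (\<forall>y\<in>{v<..1}. Orb f y \<inter> {0..<v} \<noteq> {}) \<and>
            (\<forall>x\<in>{0..1}. f x \<noteq> x) \<and>
            (f u \<in> {u<..<v} \<or> f v \<in> {u<..<v} \<longrightarrow> Fg = doubled_space f c))"
proof -
  interpret lorenz_renorm f c g m k u v
    using assms(1-4) by unfold_locales
  have eqs: "uh = lorenz_renorm.uh f c k" "vh = lorenz_renorm.vh f c m"
    by (simp_all add: assms(5,6) uh_def vh_def)
  show ?thesis
    unfolding assms(7) eqs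
    using completely_invariant_iff images_of_J_subset orbit_exceeds_u orbit_falls_below_v
      no_fixed_point f_0_pos f_1_less E_eq_X by blast
qed

end
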